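(* Let $\phi$ be an absolute positional encoding (APE) with values in $\mathbb{R}^l$. Then there exists a function $f:\mathbb{R}^l\to\mathbb{R}^{k}$ (for some $k$), inducing the relative positional encoding (RPE) $\psi^f$ given by $\psi^f_G(u,v)=f(\phi_G(u))+f(\phi_G(v))$, such that any two featured graphs $(G,X_G)$ and $(H,X_H)$ are indistinguishable by all $\phi$-APE-GTs if and only if they are indistinguishable by all $\psi^f$-RPE-GTs.
   Context: Graphs are finite and unweighted (directed or undirected). A featured graph $(G,X_G)$ is a graph with node features $X_G:V_G\to\mathbb{R}^d$, also viewed as a matrix in $\mathbb{R}^{|V_G|\times d}$; features of two compared graphs have the same dimension. Double braces denote multisets. An APE $\phi$ assigns each graph $G$ a map $\phi_G:V_G\to\mathbb{R}^l$ with $\phi_G=\phi_H\circ\sigma$ for every graph isomorphism $\sigma:V_G\to V_H$. An RPE $\psi$ assigns each graph $G$ a map $\psi_G:V_G\times V_G\to\mathbb{R}^k$ with $\psi_G=\psi_H\circ(\sigma\times\sigma)$ for every graph isomorphism $\sigma:V_G\to V_H$. Transformer: a composition of layers $X^{(l)}\mapsto X^{(l+1)}$ on $\mathbb{R}^{n\times d}$ (the same parameters being used for every $n$), where, with heads $1\le h\le H$, $$A^{(l,h)}(X)=\mathrm{softmax}\Big(\tfrac{XW_Q^{(l,h)}(XW_K^{(l,h)})^T}{\sqrt{d_h}}\Big),\quad Y^{(l)}=X^{(l)}+\Big(\sum_{h=1}^H A^{(l,h)}(X^{(l)})X^{(l)}W_V^{(l,h)}\Big)W_O^{(l)},\quad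 X^{(l+1)}=Y^{(l)}+\sigma(Y^{(l)}W_1^{(l)})W_2^{(l)},$$ with weights $W_Q,W_K,W_V\in\mathbb{R}^{d\times d_h}$, $W_O\in\mathbb{R}^{d_h\times d}$, $W_1\in\mathbb{R}^{d\times d_r}$, $W_2\in\mathbb{R}^{d_r\times d}$, row-wise softmax, and $\sigma$ an activation function applied entrywise (usually GELU). A $\phi$-APE-GT is a transformer applied to either the concatenation $[X_G|\phi_G]$ or the sum $X_G+\phi_G$ (when dimensions agree). A $\psi$-RPE-GT is a transformer applied to $X_G$ in which each attention matrix is replaced by $$A(X)=f_1(\psi_G)\odot\mathrm{softmax}\Big(\tfrac{XW_Q(XW_K)^T}{\sqrt{d_h}}+f_2(\psi_G)\Big),$$ where $f_1,f_2:\mathbb{R}^k\to\mathbb{R}$ are functions applied to each entry $\psi_G(u,v)$ (they may differ between layers and heads) and $\odot$ is the entrywise product. Two featured graphs are indistinguishable by a graph transformer if its outputs on the two graphs have the same multiset of node features (rows). *)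

theory Defs
  imports
    "Graph_Theory.Pair_Digraph"
    "Graph_Theory.Digraph_Isomorphism"
    "Jordan_Normal_Form.Matrix"
    "HOL-Library.Multiset"
    Complex_Main
begin

section \<open>Graphs, node features and positional encodings\<close>

text \<open>
  Graphs are finite digraphs without parallel arcs (\<^locale>\<open>pair_fin_digraph\<close>); undirected
  graphs are those with a symmetric arc relation. An encoding that is only of interest on some
  isomorphism-closed class of graphs (undirected, loop-free, ...) can be extended by zero to all
  of them.

  An isomorphism is the library's record of maps for general digraphs. Equality with the
  projection graph of H fixes its arc map to be the one induced by the node map.
\<close>

definition graph_isomorphism ::
  "'v pair_pre_digraph \<Rightarrow> 'v pair_pre_digraph \<Rightarrow> ('v \<Rightarrow> 'v) \<Rightarrow> bool" where
  "graph_isomorphism G H \<sigma> \<longleftrightarrow>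
     (\<exists>hom. pre_digraph.digraph_isomorphism (with_proj G) hom \<and>
            with_proj H = app_iso hom (with_proj G) \<and> \<sigma> = iso_verts hom)"

definition featured_graph ::
  "nat \<Rightarrow> 'v pair_pre_digraph \<Rightarrow> ('v \<Rightarrow> real vec) \<Rightarrow> bool" where
  "featured_graph d G X \<longleftrightarrow> pair_fin_digraph G \<and> (\<forall>v\<in>pverts G. X v \<in> carrier_vec d)"

definition is_APE :: "nat \<Rightarrow> ('v pair_pre_digraph \<Rightarrow> 'v \<Rightarrow> real vec) \<Rightarrow> bool" where
  "is_APE l \<phi> \<longleftrightarrow>
     (\<forall>G. pair_fin_digraph G \<longrightarrow> (\<forall>v\<in>pverts G. \<phi> G v \<in> carrier_vec l)) \<and>
     (\<forall>G H \<sigma>. pair_fin_digraph G \<and> pair_fin_digraph H \<and> graph_isomorphism G H \<sigma> \<longrightarrow>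
        (\<forall>v\<in>pverts G. \<phi> G v = \<phi> H (\<sigma> v)))"

definition is_RPE :: "nat \<Rightarrow> ('v pair_pre_digraph \<Rightarrow> 'v \<Rightarrow> 'v \<Rightarrow> real vec) \<Rightarrow> bool" where
  "is_RPE k \<psi> \<longleftrightarrow>
     (\<forall>G. pair_fin_digraph G \<longrightarrow> (\<forall>u\<in>pverts G. \<forall>v\<in>pverts G. \<psi> G u v \<in> carrier_vec k)) \<and>
     (\<forall>G H \<sigma>. pair_fin_digraph G \<and> pair_fin_digraph H \<and> graph_isomorphism G H \<sigma> \<longrightarrow>
        (\<forall>u\<in>pverts G. \<forall>v\<in>pverts G. \<psi> G u v = \<psi> H (\<sigma> u) (\<sigma> v)))"

definition induced_RPE ::
  "(real vec \<Rightarrow> real vec) \<Rightarrow> ('v pair_pre_digraph \<Rightarrow> 'v \<Rightarrow> real vec) \<Rightarrow>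
   'v pair_pre_digraph \<Rightarrow> 'v \<Rightarrow> 'v \<Rightarrow> real vec" where
  "induced_RPE f \<phi> G u v = f (\<phi> G u) + f (\<phi> G v)"


section \<open>Transformers\<close>

record attn_head =
  W_Q :: "real mat"
  W_K :: "real mat"
  W_V :: "real mat"

record rpe_head = attn_head +
  f_1 :: "real vec \<Rightarrow> real"
  f_2 :: "real vec \<Rightarrow> real"

record 'h layer =
  heads :: "'h list"
  W_O :: "real mat"
  W_1 :: "real mat"
  W_2 :: "real mat"

text \<open>
  The activation function is part of the data of a transformer, shared by all of its layers, so
  quantifying over all transformers includes quantifying over it. It cannot be frozen to one with
  value 0 at 0 (such as GELU): layers have no bias terms, so zero features would then stay zero
  under every relative encoding, while absolute encodings would still be visible.
\<close>

record 'h transformer =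
  activation :: "real \<Rightarrow> real"
  layers :: "'h layer list"

definition transformer_dims :: "nat \<Rightarrow> 'x attn_head_scheme transformer \<Rightarrow> bool" where
  "transformer_dims d T \<longleftrightarrow> layers T \<noteq> [] \<and>
     (\<exists>H d\<^sub>h d\<^sub>r. 1 \<le> H \<and> 1 \<le> d\<^sub>h \<and> 1 \<le> d\<^sub>r \<and>
       (\<forall>L\<in>set (layers T).
          length (heads L) = H \<and>
          (\<forall>h\<in>set (heads L). W_Q h \<in> carrier_mat d d\<^sub>h \<and>
             W_K h \<in> carrier_mat d d\<^sub>h \<and> W_V h \<in> carrier_mat d d\<^sub>h) \<and>
          W_O L \<in> carrier_mat d\<^sub>h d \<and>
          W_1 L \<in> carrier_mat d d\<^sub>r \<and>
          W_2 L \<in> carrier_mat d\<^sub>r d))"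

definition softmax :: "real mat \<Rightarrow> real mat" where
  "softmax M = mat (dim_row M) (dim_col M)
     (\<lambda>(i, j). exp (M $$ (i, j)) / (\<Sum>j'<dim_col M. exp (M $$ (i, j'))))"

definition hadamard :: "real mat \<Rightarrow> real mat \<Rightarrow> real mat" where
  "hadamard A B = mat (dim_row A) (dim_col A) (\<lambda>(i, j). A $$ (i, j) * B $$ (i, j))"

definition attn_scores :: "'x attn_head_scheme \<Rightarrow> real mat \<Rightarrow> real mat" where
  "attn_scores h X =
     (1 / sqrt (real (dim_col (W_Q h)))) \<cdot>\<^sub>m ((X * W_Q h) * transpose_mat (X * W_K h))"

definition attention :: "attn_head \<Rightarrow> real mat \<Rightarrow> real mat" where
  "attention h X = softmax (attn_scores h X)"

definition rpe_attention :: "real vec mat \<Rightarrow> rpe_head \<Rightarrow> real mat \<Rightarrow> real mat" where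
  "rpe_attention \<Psi> h X =
     hadamard (map_mat (f_1 h) \<Psi>) (softmax (attn_scores h X + map_mat (f_2 h) \<Psi>))"

definition heads_sum ::
  "('x attn_head_scheme \<Rightarrow> real mat \<Rightarrow> real mat) \<Rightarrow> 'x attn_head_scheme layer \<Rightarrow>
   real mat \<Rightarrow> real mat" where
  "heads_sum att L X = mat (dim_row X) (dim_row (W_O L))
     (\<lambda>(i, j). \<Sum>h\<leftarrow>heads L. (att h X * X * W_V h) $$ (i, j))"

definition apply_layer ::
  "('x attn_head_scheme \<Rightarrow> real mat \<Rightarrow> real mat) \<Rightarrow> (real \<Rightarrow> real) \<Rightarrow>
   'x attn_head_scheme layer \<Rightarrow> real mat \<Rightarrow> real mat" where
  "apply_layer att \<sigma> L X =
     (let Y = X + heads_sum att L X * W_O L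
      in Y + map_mat \<sigma> (Y * W_1 L) * W_2 L)"

definition run_transformer ::
  "('x attn_head_scheme \<Rightarrow> real mat \<Rightarrow> real mat) \<Rightarrow> 'x attn_head_scheme transformer \<Rightarrow>
   real mat \<Rightarrow> real mat" where
  "run_transformer att T X = fold (apply_layer att (activation T)) (layers T) X"


section \<open>Graph transformers and indistinguishability\<close>

text \<open>
  Writing node features as a matrix needs an enumeration of the nodes. A graph transformer is
  therefore a function of a graph, a list enumerating its nodes, and the node features; row i of
  every matrix belongs to the i-th node of the list.
\<close>

type_synonym 'v graph_transformer =
  "'v pair_pre_digraph \<Rightarrow> 'v list \<Rightarrow> ('v \<Rightarrow> real vec) \<Rightarrow> real mat"

definition APE_GTs ::
  "nat \<Rightarrow> nat \<Rightarrow> ('v pair_pre_digraph \<Rightarrow> 'v \<Rightarrow> real vec) \<Rightarrow> 'v graph_transformer set" where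
  "APE_GTs d l \<phi> =
     {(\<lambda>G vs X. run_transformer attention T
         (mat_of_rows (d + l) (map (\<lambda>v. X v @\<^sub>v \<phi> G v) vs))) |T. transformer_dims (d + l) T} \<union>
     {(\<lambda>G vs X. run_transformer attention T
         (mat_of_rows d (map (\<lambda>v. X v + \<phi> G v) vs))) |T. d = l \<and> transformer_dims d T}"

definition RPE_GTs ::
  "nat \<Rightarrow> ('v pair_pre_digraph \<Rightarrow> 'v \<Rightarrow> 'v \<Rightarrow> real vec) \<Rightarrow> 'v graph_transformer set" where
  "RPE_GTs d \<psi> =
     {(\<lambda>G vs X. run_transformer
         (rpe_attention (mat (length vs) (length vs) (\<lambda>(i, j). \<psi> G (vs ! i) (vs ! j)))) T
         (mat_of_rows d (map X vs))) |T. transformer_dims d T}"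

definition enumerates :: "'v list \<Rightarrow> 'v pair_pre_digraph \<Rightarrow> bool" where
  "enumerates vs G \<longleftrightarrow> distinct vs \<and> set vs = pverts G"

text \<open>
  By permutation equivariance, the multiset of output rows does not depend on the enumeration.
\<close>

definition indistinguishable ::
  "'v graph_transformer \<Rightarrow> 'v pair_pre_digraph \<times> ('v \<Rightarrow> real vec) \<Rightarrow>
   'v pair_pre_digraph \<times> ('v \<Rightarrow> real vec) \<Rightarrow> bool" where
  "indistinguishable F = (\<lambda>(G, X\<^sub>G) (H, X\<^sub>H).
     \<forall>vs ws. enumerates vs G \<and> enumerates ws H \<longrightarrow>
       mset (rows (F G vs X\<^sub>G)) = mset (rows (F H ws X\<^sub>H)))"

end

theory Submission
  imports Defs "HOL-Combinatorics.Permutations"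
begin

text \<open>
  Both kinds of indistinguishability amount to equality of the multisets of pairs of node feature
  and absolute encoding. If these multisets agree, a matching of the nodes respects all inputs and
  every transformer is permutation equivariant. Conversely, a transformer with zero weights
  exposes the absolute encodings. For the relative ones, lift the encoding to the paraboloid by
  \<open>f a = (a \<bullet> a, a)\<close>: by strict convexity, \<open>f a + f b = f p + f p\<close> only if \<open>a = b = p\<close>, so for
  every p the function \<open>f\<^sub>1\<close> can select exactly the pairs of nodes that are both encoded by p. One
  attention layer then shifts the first coordinate of precisely the nodes encoded by p, by an
  amount so large that their features can be read off from the multiset of outputs.
\<close>

section \<open>Permutation equivariance\<close>

definition permute_rows :: "(nat \<Rightarrow> nat) \<Rightarrow> 'a mat \<Rightarrow> 'a mat" where
  "permute_rows \<pi> A = mat (dim_row A) (dim_col A) (\<lambda>(i, j). A $$ (\<pi> i, j))"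

text \<open>With P the matrix of \<open>\<pi>\<close>, this is conjugation P A P^T, while
  \<open>permute_rows\<close> is P A. Feature matrices have nodes on one side only, attention
  matrices and relative encodings on both. The direction agrees with \<open>permute_list\<close>, so
  no inverse permutations appear.\<close>

definition permute_both :: "(nat \<Rightarrow> nat) \<Rightarrow> 'a mat \<Rightarrow> 'a mat" where
  "permute_both \<pi> A = mat (dim_row A) (dim_col A) (\<lambda>(i, j). A $$ (\<pi> i, \<pi> j))"

lemma permute_rows_simps [simp]:
  "dim_row (permute_rows \<pi> A) = dim_row A"
  "dim_col (permute_rows \<pi> A) = dim_col A"
  "i < dim_row A \<Longrightarrow> j < dim_col A \<Longrightarrow> permute_rows \<pi> A $$ (i, j) = A $$ (\<pi> i, j)"
  "permute_rows \<pi> A \<in> carrier_mat n m \<longleftrightarrow> A \<in> carrier_mat n m"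
  unfolding permute_rows_def carrier_mat_def by auto

lemma permute_both_simps [simp]:
  "dim_row (permute_both \<pi> A) = dim_row A"
  "dim_col (permute_both \<pi> A) = dim_col A"
  "i < dim_row A \<Longrightarrow> j < dim_col A \<Longrightarrow> permute_both \<pi> A $$ (i, j) = A $$ (\<pi> i, \<pi> j)"
  "permute_both \<pi> A \<in> carrier_mat n m \<longleftrightarrow> A \<in> carrier_mat n m"
  unfolding permute_both_def carrier_mat_def by auto

lemma index_mult_mat_sum:
  assumes "A \<in> carrier_mat n m" "B \<in> carrier_mat m k" "i < n" "j < k"
  shows "(A * B) $$ (i, j) = (\<Sum>q<m. A $$ (i, q) * B $$ (q, j))"
  using assms by (auto simp: scalar_prod_def lessThan_atLeast0)

lemma permutes_lessThan [simp]: "\<pi> permutes {..<n} \<Longrightarrow> \<pi> i < n \<longleftrightarrow> i < (n::nat)"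
  using permutes_in_image[of \<pi> "{..<n}" i] by simp

lemma sum_permutes_lessThan:
  fixes n :: nat
  assumes "\<pi> permutes {..<n}"
  shows "(\<Sum>q<n. f (\<pi> q)) = (\<Sum>q<n. f q)"
  using sum.permute[OF assms, of f] by (simp add: o_def)

lemma permute_rows_mult:
  assumes "\<pi> permutes {..<n}" "A \<in> carrier_mat n m" "B \<in> carrier_mat m k"
  shows "permute_rows \<pi> A * B = permute_rows \<pi> (A * B)"
proof (rule eq_matI)
  fix i j assume "i < dim_row (permute_rows \<pi> (A * B))" "j < dim_col (permute_rows \<pi> (A * B))"
  with assms have ij: "i < n" "j < k" by auto
  have "(permute_rows \<pi> A * B) $$ (i, j) = (\<Sum>q<m. permute_rows \<pi> A $$ (i, q) * B $$ (q, j))"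
    using assms ij by (intro index_mult_mat_sum) auto
  also have "\<dots> = (\<Sum>q<m. A $$ (\<pi> i, q) * B $$ (q, j))"
    using assms ij by auto
  also have "\<dots> = (A * B) $$ (\<pi> i, j)"
    using assms ij by (intro index_mult_mat_sum[symmetric]) auto
  finally show "(permute_rows \<pi> A * B) $$ (i, j) = permute_rows \<pi> (A * B) $$ (i, j)"
    using assms ij by (subst permute_rows_simps(3)) auto
qed (use assms in auto)

text \<open>The inner index runs over the nodes, so reindexing the sum by \<open>\<pi>\<close>
  cancels the column permutation of \<open>A\<close> against the row permutation of
  \<open>B\<close>.\<close>

lemma permute_both_mult:
  assumes "\<pi> permutes {..<n}" "A \<in> carrier_mat n n" "B \<in> carrier_mat n k"
  shows "permute_both \<pi> A * permute_rows \<pi> B = permute_rows \<pi> (A * B)"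
proof (rule eq_matI)
  fix i j assume "i < dim_row (permute_rows \<pi> (A * B))" "j < dim_col (permute_rows \<pi> (A * B))"
  with assms have ij: "i < n" "j < k" by auto
  have "(permute_both \<pi> A * permute_rows \<pi> B) $$ (i, j) =
      (\<Sum>q<n. permute_both \<pi> A $$ (i, q) * permute_rows \<pi> B $$ (q, j))"
    using assms ij by (intro index_mult_mat_sum) auto
  also have "\<dots> = (\<Sum>q<n. A $$ (\<pi> i, \<pi> q) * B $$ (\<pi> q, j))"
    using assms ij by auto
  also have "\<dots> = (\<Sum>q<n. A $$ (\<pi> i, q) * B $$ (q, j))"
    by (rule sum_permutes_lessThan[OF assms(1)])
  also have "\<dots> = (A * B) $$ (\<pi> i, j)"
    using assms ij by (intro index_mult_mat_sum[symmetric]) auto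
  finally show "(permute_both \<pi> A * permute_rows \<pi> B) $$ (i, j) = permute_rows \<pi> (A * B) $$ (i, j)"
    using assms ij by (subst permute_rows_simps(3)) auto
qed (use assms in auto)

lemma permute_rows_add:
  assumes "\<pi> permutes {..<n}" "A \<in> carrier_mat n m" "B \<in> carrier_mat n m"
  shows "permute_rows \<pi> A + permute_rows \<pi> B = permute_rows \<pi> (A + B)"
  using assms by (intro eq_matI) auto

lemma permute_rows_map:
  assumes "\<pi> permutes {..<n}" "A \<in> carrier_mat n m"
  shows "map_mat f (permute_rows \<pi> A) = permute_rows \<pi> (map_mat f A)"
  using assms by (intro eq_matI) auto

text \<open>Here the inner index runs over feature coordinates and stays fixed; the two row
  permutations become a row and a column permutation of the product.\<close>

lemma permute_rows_outer:
  assumes "\<pi> permutes {..<n}" "A \<in> carrier_mat n m" "B \<in> carrier_mat n m"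
  shows "permute_rows \<pi> A * transpose_mat (permute_rows \<pi> B) = permute_both \<pi> (A * transpose_mat B)"
proof (rule eq_matI)
  fix i j
  assume "i < dim_row (permute_both \<pi> (A * transpose_mat B))"
    "j < dim_col (permute_both \<pi> (A * transpose_mat B))"
  with assms have ij: "i < n" "j < n" by auto
  have "(permute_rows \<pi> A * transpose_mat (permute_rows \<pi> B)) $$ (i, j) =
      (\<Sum>q<m. permute_rows \<pi> A $$ (i, q) * transpose_mat (permute_rows \<pi> B) $$ (q, j))"
    using assms ij by (intro index_mult_mat_sum) auto
  also have "\<dots> = (\<Sum>q<m. A $$ (\<pi> i, q) * transpose_mat B $$ (q, \<pi> j))"
    using assms ij by (intro sum.cong) auto
  also have "\<dots> = (A * transpose_mat B) $$ (\<pi> i, \<pi> j)"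
    using assms ij by (intro index_mult_mat_sum[symmetric]) auto
  finally show "(permute_rows \<pi> A * transpose_mat (permute_rows \<pi> B)) $$ (i, j) =
      permute_both \<pi> (A * transpose_mat B) $$ (i, j)"
    using assms ij by (subst permute_both_simps(3)) auto
qed (use assms in auto)

section \<open>Softmax and attention under node permutations\<close>

lemma softmax_carrier [simp]: "softmax A \<in> carrier_mat n m \<longleftrightarrow> A \<in> carrier_mat n m"
  unfolding softmax_def carrier_mat_def by auto

text \<open>The normalising sum runs over a whole row and does not see the order of its
  entries.\<close>

lemma softmax_permute_both:
  assumes "\<pi> permutes {..<n}" "A \<in> carrier_mat n n"
  shows "softmax (permute_both \<pi> A) = permute_both \<pi> (softmax A)"
proof (rule eq_matI)
  fix i j assume "i < dim_row (permute_both \<pi> (softmax A))" "j < dim_col (permute_both \<pi> (softmax A))"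
  with assms have ij: "i < n" "j < n" by (auto simp: softmax_def)
  have "(\<Sum>q<n. exp (A $$ (\<pi> i, \<pi> q))) = (\<Sum>q<n. exp (A $$ (\<pi> i, q)))"
    by (rule sum_permutes_lessThan[OF assms(1)])
  with assms ij show "softmax (permute_both \<pi> A) $$ (i, j) = permute_both \<pi> (softmax A) $$ (i, j)"
    by (auto simp: softmax_def)
qed (use assms in \<open>auto simp: softmax_def\<close>)

lemma hadamard_permute_both:
  assumes "\<pi> permutes {..<n}" "A \<in> carrier_mat n n" "B \<in> carrier_mat n n"
  shows "hadamard (permute_both \<pi> A) (permute_both \<pi> B) = permute_both \<pi> (hadamard A B)"
  using assms by (intro eq_matI) (auto simp: hadamard_def)

lemma map_permute_both:
  assumes "\<pi> permutes {..<n}" "A \<in> carrier_mat n n"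
  shows "map_mat f (permute_both \<pi> A) = permute_both \<pi> (map_mat f A)"
  using assms by (intro eq_matI) auto

lemma attn_scores_carrier:
  assumes "X \<in> carrier_mat n d" "W_Q h \<in> carrier_mat d m" "W_K h \<in> carrier_mat d m"
  shows "attn_scores h X \<in> carrier_mat n n"
  using assms by (auto simp: attn_scores_def)

lemma attn_scores_permute_rows:
  assumes "\<pi> permutes {..<n}" "X \<in> carrier_mat n d"
    and "W_Q h \<in> carrier_mat d m" "W_K h \<in> carrier_mat d m"
  shows "attn_scores h (permute_rows \<pi> X) = permute_both \<pi> (attn_scores h X)"
proof -
  have "attn_scores h (permute_rows \<pi> X) = (1 / sqrt (real (dim_col (W_Q h)))) \<cdot>\<^sub>m
      permute_both \<pi> ((X * W_Q h) * transpose_mat (X * W_K h))"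
    using assms unfolding attn_scores_def
    by (simp add: permute_rows_mult[of \<pi> n _ d _ m] permute_rows_outer[of \<pi> n _ m])
  also have "\<dots> = permute_both \<pi> (attn_scores h X)"
    using assms unfolding attn_scores_def by (intro eq_matI) auto
  finally show ?thesis .
qed

lemma attention_carrier:
  assumes "X \<in> carrier_mat n d" "W_Q h \<in> carrier_mat d m" "W_K h \<in> carrier_mat d m"
  shows "attention h X \<in> carrier_mat n n"
  using attn_scores_carrier[OF assms] by (simp add: attention_def)

lemma attention_permute_rows:
  assumes "\<pi> permutes {..<n}" "X \<in> carrier_mat n d"
    and "W_Q h \<in> carrier_mat d m" "W_K h \<in> carrier_mat d m"
  shows "attention h (permute_rows \<pi> X) = permute_both \<pi> (attention h X)"
  using attn_scores_permute_rows[OF assms] attn_scores_carrier[OF assms(2-)] assms(1)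
  by (simp add: attention_def softmax_permute_both)

lemma rpe_attention_carrier:
  assumes "\<Psi> \<in> carrier_mat n n"
  shows "rpe_attention \<Psi> h X \<in> carrier_mat n n"
  using assms by (auto simp: rpe_attention_def hadamard_def)

lemma rpe_attention_permute_rows:
  assumes "\<pi> permutes {..<n}" "\<Psi> \<in> carrier_mat n n" "X \<in> carrier_mat n d"
    and "W_Q h \<in> carrier_mat d m" "W_K h \<in> carrier_mat d m"
  shows "rpe_attention (permute_both \<pi> \<Psi>) h (permute_rows \<pi> X) =
    permute_both \<pi> (rpe_attention \<Psi> h X)"
proof -
  let ?S = "attn_scores h X + map_mat (f_2 h) \<Psi>"
  \<comment> \<open>A matrix sum takes its dimensions from the second summand, here the encoding
    matrix.\<close>
  have S: "?S \<in> carrier_mat n n"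
    using assms(2) by auto
  then have SS: "softmax ?S \<in> carrier_mat n n"
    by (simp only: softmax_carrier)
  have "attn_scores h X \<in> carrier_mat n n"
    using attn_scores_carrier[OF assms(3-)] .
  then have "attn_scores h (permute_rows \<pi> X) + map_mat (f_2 h) (permute_both \<pi> \<Psi>) =
      permute_both \<pi> ?S"
    using assms(1,2) attn_scores_permute_rows[OF assms(1,3-)] by (intro eq_matI) auto
  then have "rpe_attention (permute_both \<pi> \<Psi>) h (permute_rows \<pi> X) =
      hadamard (map_mat (f_1 h) (permute_both \<pi> \<Psi>)) (permute_both \<pi> (softmax ?S))"
    using softmax_permute_both[OF assms(1) S] by (simp add: rpe_attention_def)
  also have "\<dots> = permute_both \<pi> (rpe_attention \<Psi> h X)"
    using assms(1,2) SS by (auto simp: rpe_attention_def hadamard_permute_both[OF assms(1) _ SS]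
        map_permute_both[OF assms(1,2)])
  finally show ?thesis .
qed

section \<open>Layers and whole transformers\<close>

definition layer_dims :: "nat \<Rightarrow> nat \<Rightarrow> nat \<Rightarrow> 'x attn_head_scheme layer \<Rightarrow> bool" where
  "layer_dims d d\<^sub>h d\<^sub>r L \<longleftrightarrow>
     (\<forall>h\<in>set (heads L). W_Q h \<in> carrier_mat d d\<^sub>h \<and>
        W_K h \<in> carrier_mat d d\<^sub>h \<and> W_V h \<in> carrier_mat d d\<^sub>h) \<and>
     W_O L \<in> carrier_mat d\<^sub>h d \<and> W_1 L \<in> carrier_mat d d\<^sub>r \<and> W_2 L \<in> carrier_mat d\<^sub>r d"

lemma apply_layer_carrier:
  assumes "layer_dims d d\<^sub>h d\<^sub>r L" "X \<in> carrier_mat n d"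
  shows "apply_layer att \<sigma> L X \<in> carrier_mat n d"
  using assms by (auto simp: apply_layer_def layer_dims_def heads_sum_def Let_def)

text \<open>Apart from attention, a layer only adds, multiplies by weights from the right and maps
  entrywise, all of which commute with row permutations. Two attention maps \<open>att\<close> and
  \<open>att'\<close> appear because a relative encoding is built into the map and has to be
  permuted along with the features.\<close>

lemma apply_layer_permute_rows:
  assumes \<pi>: "\<pi> permutes {..<n}" and L: "layer_dims d d\<^sub>h d\<^sub>r L" and X: "X \<in> carrier_mat n d"
    and att: "\<And>h. h \<in> set (heads L) \<Longrightarrow>
      att h X \<in> carrier_mat n n \<and> att' h (permute_rows \<pi> X) = permute_both \<pi> (att h X)"
  shows "apply_layer att' \<sigma> L (permute_rows \<pi> X) = permute_rows \<pi> (apply_layer att \<sigma> L X)"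
proof -
  have head: "att' h (permute_rows \<pi> X) * permute_rows \<pi> X * W_V h =
      permute_rows \<pi> (att h X * X * W_V h)" if "h \<in> set (heads L)" for h
  proof -
    have "W_V h \<in> carrier_mat d d\<^sub>h" using L that by (auto simp: layer_dims_def)
    moreover have "att h X * X \<in> carrier_mat n d" using att[OF that] X by auto
    ultimately have "permute_rows \<pi> (att h X * X) * W_V h = permute_rows \<pi> (att h X * X * W_V h)"
      by (intro permute_rows_mult[OF \<pi>])
    moreover have "permute_both \<pi> (att h X) * permute_rows \<pi> X = permute_rows \<pi> (att h X * X)"
      using att[OF that] X by (intro permute_both_mult[OF \<pi>]) auto
    ultimately show ?thesis
      using att[OF that] by simp
  qed
  have WO: "W_O L \<in> carrier_mat d\<^sub>h d" and W1: "W_1 L \<in> carrier_mat d d\<^sub>r"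
    and W2: "W_2 L \<in> carrier_mat d\<^sub>r d"
    using L by (auto simp: layer_dims_def)
  have hs: "heads_sum att L X \<in> carrier_mat n d\<^sub>h"
    using WO X by (auto simp: heads_sum_def)
  have "heads_sum att' L (permute_rows \<pi> X) = permute_rows \<pi> (heads_sum att L X)"
  proof (rule eq_matI)
    fix i j assume "i < dim_row (permute_rows \<pi> (heads_sum att L X))"
      "j < dim_col (permute_rows \<pi> (heads_sum att L X))"
    with hs have ij: "i < n" "j < d\<^sub>h" by auto
    have "(att' h (permute_rows \<pi> X) * permute_rows \<pi> X * W_V h) $$ (i, j) =
      (att h X * X * W_V h) $$ (\<pi> i, j)" if "h \<in> set (heads L)" for h
    proof -
      have "att h X * X * W_V h \<in> carrier_mat n d\<^sub>h"
        using att[OF that] X L that by (auto simp: layer_dims_def)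
      then show ?thesis
        unfolding head[OF that] using ij by (subst permute_rows_simps(3)) auto
    qed
    then show "heads_sum att' L (permute_rows \<pi> X) $$ (i, j) =
        permute_rows \<pi> (heads_sum att L X) $$ (i, j)"
      using ij X WO \<pi> by (auto simp: heads_sum_def intro!: arg_cong[of _ _ sum_list])
  qed (use X in \<open>auto simp: heads_sum_def\<close>)
  moreover define Y where "Y = X + heads_sum att L X * W_O L"
  ultimately have Y': "permute_rows \<pi> X + heads_sum att' L (permute_rows \<pi> X) * W_O L = permute_rows \<pi> Y"
    using \<pi> X hs WO by (simp add: permute_rows_mult[of \<pi> n _ d\<^sub>h _ d] permute_rows_add[of \<pi> n _ d])
  have Y: "Y \<in> carrier_mat n d"
    using X hs WO by (auto simp: Y_def)
  have "map_mat \<sigma> (permute_rows \<pi> Y * W_1 L) * W_2 L = permute_rows \<pi> (map_mat \<sigma> (Y * W_1 L) * W_2 L)"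
    using \<pi> Y W1 W2
    by (simp add: permute_rows_mult[of \<pi> n _ d _ d\<^sub>r] permute_rows_map[of \<pi> n _ d\<^sub>r]
        permute_rows_mult[of \<pi> n _ d\<^sub>r _ d])
  moreover have "map_mat \<sigma> (Y * W_1 L) * W_2 L \<in> carrier_mat n d"
    using Y W1 W2 by auto
  ultimately show ?thesis
    using \<pi> Y by (simp add: apply_layer_def Let_def Y' Y_def[symmetric] permute_rows_add[of \<pi> n _ d])
qed

lemma run_transformer_carrier:
  assumes T: "transformer_dims d T" and X: "X \<in> carrier_mat n d"
  shows "run_transformer att T X \<in> carrier_mat n d"
proof -
  obtain d\<^sub>h d\<^sub>r where "\<forall>L\<in>set (layers T). layer_dims d d\<^sub>h d\<^sub>r L"
    using T unfolding transformer_dims_def layer_dims_def by metis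
  moreover have "fold (apply_layer att \<sigma>) Ls Z \<in> carrier_mat n d"
    if "\<forall>L\<in>set Ls. layer_dims d d\<^sub>h d\<^sub>r L" "Z \<in> carrier_mat n d" for \<sigma> Ls Z
    using that by (induction Ls arbitrary: Z) (auto intro: apply_layer_carrier)
  ultimately show ?thesis
    using X by (simp add: run_transformer_def)
qed

text \<open>Equivariance of attention is assumed for all feature matrices \<open>Z\<close>, since
  the induction over the layers meets the intermediate features and not only the input.\<close>

lemma run_transformer_permute_rows:
  assumes \<pi>: "\<pi> permutes {..<n}" and T: "transformer_dims d T" and X: "X \<in> carrier_mat n d"
    and att: "\<And>h m Z. \<lbrakk>Z \<in> carrier_mat n d; W_Q h \<in> carrier_mat d m; W_K h \<in> carrier_mat d m\<rbrakk> \<Longrightarrow>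
      att h Z \<in> carrier_mat n n \<and> att' h (permute_rows \<pi> Z) = permute_both \<pi> (att h Z)"
  shows "run_transformer att' T (permute_rows \<pi> X) = permute_rows \<pi> (run_transformer att T X)"
proof -
  obtain d\<^sub>h d\<^sub>r where "\<forall>L\<in>set (layers T). layer_dims d d\<^sub>h d\<^sub>r L"
    using T unfolding transformer_dims_def layer_dims_def by metis
  moreover have "fold (apply_layer att' \<sigma>) Ls (permute_rows \<pi> Z) =
      permute_rows \<pi> (fold (apply_layer att \<sigma>) Ls Z)"
    if "\<forall>L\<in>set Ls. layer_dims d d\<^sub>h d\<^sub>r L" "Z \<in> carrier_mat n d" for \<sigma> Ls Z
    using that
  proof (induction Ls arbitrary: Z)
    case (Cons L Ls)
    have L: "layer_dims d d\<^sub>h d\<^sub>r L" using Cons.prems by simp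
    have "apply_layer att' \<sigma> L (permute_rows \<pi> Z) = permute_rows \<pi> (apply_layer att \<sigma> L Z)"
      using L Cons.prems(2)
      by (intro apply_layer_permute_rows[OF \<pi> L] att[where m = d\<^sub>h]) (auto simp: layer_dims_def)
    with Cons apply_layer_carrier[OF L Cons.prems(2)] show ?case by simp
  qed simp
  ultimately show ?thesis
    using X by (simp add: run_transformer_def)
qed

lemma mset_rows_permute_rows:
  assumes "\<pi> permutes {..<dim_row A}"
  shows "mset (rows (permute_rows \<pi> A)) = mset (rows A)"
proof -
  have "rows (permute_rows \<pi> A) = permute_list \<pi> (rows A)"
    using assms by (intro nth_equalityI) (auto simp: permute_list_nth)
  with assms show ?thesis by simp
qed

lemma mset_rows_run_transformer_eq:
  assumes "\<pi> permutes {..<n}" "transformer_dims d T" "X \<in> carrier_mat n d"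
    and "\<And>h m Z. \<lbrakk>Z \<in> carrier_mat n d; W_Q h \<in> carrier_mat d m; W_K h \<in> carrier_mat d m\<rbrakk> \<Longrightarrow>
      att h Z \<in> carrier_mat n n \<and> att' h (permute_rows \<pi> Z) = permute_both \<pi> (att h Z)"
  shows "mset (rows (run_transformer att' T (permute_rows \<pi> X))) = mset (rows (run_transformer att T X))"
proof -
  have "run_transformer att' T (permute_rows \<pi> X) = permute_rows \<pi> (run_transformer att T X)"
    by (rule run_transformer_permute_rows[OF assms(1-3)]) (rule assms(4))
  moreover have "run_transformer att T X \<in> carrier_mat n d"
    by (rule run_transformer_carrier[OF assms(2,3)])
  ultimately show ?thesis
    using assms(1) by (simp add: mset_rows_permute_rows)
qed

section \<open>Separation by a relative encoding\<close>

lemma inj_on_image_mset_eqD: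
  assumes "inj_on f S" "set_mset A \<subseteq> S" "set_mset B \<subseteq> S" "image_mset f A = image_mset f B"
  shows "A = B"
proof -
  have "inj_on f (set_mset A \<union> set_mset B)"
    using assms(1-3) by (meson inj_on_subset le_sup_iff)
  \<comment> \<open>The image of \<open>A\<close> is read as the image of \<open>B\<close> plus an
    empty remainder, which forces \<open>C\<close> to be empty.\<close>
  then have "\<exists>C. A = B + C \<and> {#} = image_mset f C"
    using assms(4) by (intro image_mset_eq_image_mset_plusD) simp_all
  then show ?thesis
    by (metis add_0_right image_mset_is_empty_iff)
qed

text \<open>
  The elements shifted by the larger amount are those with \<open>h > K\<close>. Comparing the sums of h over
  them gives \<open>c = c'\<close>, and the shift can be undone.
\<close>

lemma multiset_shift_separation:
  fixes h :: "'a \<Rightarrow> real" and s :: "real \<Rightarrow> 'a \<Rightarrow> 'a"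
  assumes inj: "\<And>r. inj_on (s r) S" and h: "\<And>r x. x \<in> S \<Longrightarrow> h (s r x) = h x + r"
    and AB: "set_mset A \<union> set_mset B \<union> set_mset A' \<union> set_mset B' \<subseteq> S"
    and bd: "\<And>x. x \<in> set_mset A \<union> set_mset B \<union> set_mset A' \<union> set_mset B' \<Longrightarrow> 1 \<le> h x + C \<and> h x + C \<le> K"
    and c: "c = (\<Sum>x\<in>#A. h x + C)" and c': "c' = (\<Sum>x\<in>#A'. h x + C)"
    and eq: "image_mset (s (C + K * c)) A + image_mset (s C) B =
      image_mset (s (C + K * c')) A' + image_mset (s C) B'"
  shows "A = A'"
proof -
  \<comment> \<open>Generic \<open>P\<close>, \<open>Q\<close>, \<open>b\<close> serve both sides of
    \<open>eq\<close>. If \<open>P\<close> has an element then \<open>b\<close> is at least 1, so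
    the elements of \<open>P\<close> land at \<open>h x + C + K * b\<close>, at least
    \<open>1 + K\<close>, while those of \<open>Q\<close> land at \<open>h x + C\<close>, at most
    \<open>K\<close>.\<close>
  have split: "filter_mset (\<lambda>y. h y > K) (image_mset (s (C + K * b)) P + image_mset (s C) Q) =
      image_mset (s (C + K * b)) P"
    if PQ: "set_mset P \<union> set_mset Q \<subseteq> set_mset A \<union> set_mset B \<union> set_mset A' \<union> set_mset B'"
      and b: "b = (\<Sum>x\<in>#P. h x + C)" for P Q b
  proof -
    have "h (s (C + K * b) x) > K" if x: "x \<in># P" for x
    proof -
      obtain R where R: "P = add_mset x R" using x by (meson multi_member_split)
      \<comment> \<open>One summand of \<open>b\<close> is at least 1 and the others are
        nonnegative: this is where the absence of cancellation enters.\<close>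
      have "\<forall>y\<in>#R. 0 \<le> h y + C"
        using bd PQ R by fastforce
      then have "0 \<le> (\<Sum>y\<in>#R. h y + C)"
        by (induction R) auto
      moreover have bx: "1 \<le> h x + C" "h x + C \<le> K" "x \<in> S" using bd[of x] AB PQ x by auto
      ultimately have "1 \<le> b" unfolding b R by simp
      then have "K * 1 \<le> K * b" using bx by (intro mult_left_mono) auto
      with bx h[OF bx(3), of "C + K * b"] show ?thesis by linarith
    qed
    then have "filter_mset (\<lambda>y. h y > K) (image_mset (s (C + K * b)) P) = image_mset (s (C + K * b)) P"
      by (auto simp: filter_mset_eq_conv)
    moreover have "\<not> h (s C x) > K" if "x \<in># Q" for x
      using bd[of x] AB PQ that h[of x] by force
    then have "filter_mset (\<lambda>y. h y > K) (image_mset (s C) Q) = {#}"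
      by (auto simp: filter_mset_eq_mempty_iff)
    ultimately show ?thesis by simp
  qed
  have img: "image_mset (s (C + K * c)) A = image_mset (s (C + K * c')) A'"
  proof -
    have "set_mset A \<union> set_mset B \<subseteq> set_mset A \<union> set_mset B \<union> set_mset A' \<union> set_mset B'"
      "set_mset A' \<union> set_mset B' \<subseteq> set_mset A \<union> set_mset B \<union> set_mset A' \<union> set_mset B'"
      by blast+
    from split[OF this(1) c] split[OF this(2) c'] show ?thesis
      unfolding eq by (rule trans[OF sym])
  qed
  then have N: "size A = size A'" by (metis size_image_mset)
  have sumh: "(\<Sum>y\<in>#image_mset (s r) P. h y + C) = (\<Sum>x\<in>#P. h x + C) + real (size P) * r"
    if "set_mset P \<subseteq> S" for P and r :: real
    using that by (induction P) (auto simp: h algebra_simps)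
  \<comment> \<open>The shift depends on the unknown sum itself. Summing \<open>h + C\<close> over
    both sides of \<open>img\<close> makes each total an affine function of that sum, with the same
    slope \<open>1 + real (size A) * K\<close>; a positive slope then gives
    \<open>c = c'\<close>.\<close>
  have "c + real (size A) * (C + K * c) = c' + real (size A) * (C + K * c')"
    using sumh[of A "C + K * c"] sumh[of A' "C + K * c'"] AB img N c c' by simp
  then have *: "(1 + real (size A) * K) * (c - c') = 0" by (simp add: algebra_simps)
  show ?thesis
  \<comment> \<open>Positivity of \<open>K\<close> is obtained from an element of \<open>A\<close>;
    without one, equality of sizes suffices.\<close>
  proof (cases "A = {#}")
    case True
    with N show ?thesis by simp
  next
    case False
    then obtain x where "x \<in># A" by auto
    then have "1 \<le> K" using bd[of x] by auto
    then have "0 < 1 + real (size A) * K" by (simp add: add_pos_nonneg)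
    with * have cc: "c = c'" by auto
    show ?thesis
      using inj_on_image_mset_eqD[OF inj] AB img unfolding cc by simp
  qed
qed

text \<open>The later coordinates give a + b = 2p, the first one |a|^2 + |b|^2 = 2|p|^2. By the
  parallelogram law, |a - b|^2 = 4|p|^2 - 4|p|^2 = 0.\<close>

lemma paraboloid_midpoint:
  fixes a b p :: "real vec"
  assumes "a \<in> carrier_vec l" "b \<in> carrier_vec l" "p \<in> carrier_vec l"
    and eq: "vCons (a \<bullet> a) a + vCons (b \<bullet> b) b = vCons (p \<bullet> p) p + vCons (p \<bullet> p) p"
  shows "a = p \<and> b = p"
proof -
  have "(vCons (a \<bullet> a) a + vCons (b \<bullet> b) b) $ 0 = (vCons (p \<bullet> p) p + vCons (p \<bullet> p) p) $ 0"
    using eq by simp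
  then have sq: "a \<bullet> a + b \<bullet> b = p \<bullet> p + p \<bullet> p"
    by simp
  have co: "a $ i + b $ i = 2 * p $ i" if "i < l" for i
  proof -
    have "(vCons (a \<bullet> a) a + vCons (b \<bullet> b) b) $ Suc i = (vCons (p \<bullet> p) p + vCons (p \<bullet> p) p) $ Suc i"
      using eq by simp
    with that assms(1-3) show ?thesis by simp
  qed
  have "(\<Sum>i<l. (a $ i - b $ i)\<^sup>2) = 2 * (a \<bullet> a + b \<bullet> b) - (\<Sum>i<l. (a $ i + b $ i)\<^sup>2)"
    using assms by (simp add: scalar_prod_def lessThan_atLeast0 power2_eq_square algebra_simps
        sum.distrib sum_subtractf sum_distrib_left)
  also have "(\<Sum>i<l. (a $ i + b $ i)\<^sup>2) = (\<Sum>i<l. (2 * p $ i)\<^sup>2)"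
    using co by (intro sum.cong) auto
  also have "\<dots> = 4 * (p \<bullet> p)"
    using assms by (simp add: scalar_prod_def lessThan_atLeast0 power2_eq_square sum_distrib_left)
  finally have "(\<Sum>i<l. (a $ i - b $ i)\<^sup>2) = 0" using sq by simp
  then have ab: "a $ i = b $ i" if "i < l" for i
    using that by (subst (asm) sum_nonneg_eq_0_iff) auto
  have "a = p"
    using ab co assms by (intro eq_vecI) force+
  moreover have "b = p"
    using ab co assms by (intro eq_vecI) force+
  ultimately show ?thesis by simp
qed

section \<open>The probing transformer\<close>

definition probe_head :: "nat \<Rightarrow> (real vec \<Rightarrow> real) \<Rightarrow> rpe_head" where
  "probe_head d g = \<lparr>W_Q = 0\<^sub>m d 1, W_K = 0\<^sub>m d 1, W_V = mat d 1 (\<lambda>(i, j). if i = 0 then 1 else 0),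
     f_1 = g, f_2 = (\<lambda>_. 0)\<rparr>"

text \<open>
  The first layer makes all first coordinates positive, so that no sum of values in the second
  layer can cancel; the second one sums them with weights g.
\<close>

definition probe :: "nat \<Rightarrow> real \<Rightarrow> (real vec \<Rightarrow> real) \<Rightarrow> rpe_head transformer" where
  "probe d C g = \<lparr>activation = (\<lambda>_. 1), layers =
     [\<lparr>heads = [probe_head d g], W_O = 0\<^sub>m 1 d, W_1 = 0\<^sub>m d 1,
        W_2 = mat 1 d (\<lambda>(i, j). if j = 0 then C else 0)\<rparr>,
      \<lparr>heads = [probe_head d g], W_O = mat 1 d (\<lambda>(i, j). if j = 0 then 1 else 0), W_1 = 0\<^sub>m d 1,
        W_2 = 0\<^sub>m 1 d\<rparr>]\<rparr>"

lemma probe_dims: "transformer_dims d (probe d C g)"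
  unfolding transformer_dims_def
  by (intro conjI exI[of _ 1]) (auto simp: probe_def probe_head_def)

text \<open>Zero query and key weights together with \<open>f_2 = 0\<close> make the softmax
  uniform, so \<open>f_1\<close> alone decides which pairs of nodes attend to each other.\<close>

lemma rpe_attention_probe_head:
  assumes "\<Psi> \<in> carrier_mat n n" "X \<in> carrier_mat n d" "i < n" "j < n"
  shows "rpe_attention \<Psi> (probe_head d g) X $$ (i, j) = g (\<Psi> $$ (i, j)) / n"
proof -
  have "attn_scores (probe_head d g) X $$ (i, q) = 0" if "q < n" for q
    using assms that by (simp add: attn_scores_def probe_head_def)
  then show ?thesis
    using assms by (simp add: rpe_attention_def hadamard_def softmax_def probe_head_def)
qed

text \<open>In the first layer \<open>W_O\<close> is zero and the constant activation 1 turns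
  \<open>W_2\<close> into a bias, adding \<open>C\<close> to coordinate 0. In the second layer
  \<open>W_2\<close> is zero, \<open>W_V\<close> reads coordinate 0 of the raised features and
  \<open>W_O\<close> writes the attended sum back to coordinate 0.\<close>

lemma run_probe:
  assumes \<Psi>: "\<Psi> \<in> carrier_mat n n" and X: "X \<in> carrier_mat n d" and i: "i < n" and j: "j < d"
  shows "run_transformer (rpe_attention \<Psi>) (probe d C g) X $$ (i, j) =
    X $$ (i, j) + (if j = 0 then C + (\<Sum>k<n. g (\<Psi> $$ (i, k)) / n * (X $$ (k, 0) + C)) else 0)"
proof -
  let ?h = "probe_head d g"
  let ?L1 = "layers (probe d C g) ! 0" and ?L2 = "layers (probe d C g) ! 1"
  define Z where "Z = apply_layer (rpe_attention \<Psi>) (\<lambda>_. 1) ?L1 X"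
  have Z: "Z \<in> carrier_mat n d"
    unfolding Z_def using X by (intro apply_layer_carrier[of d 1 1])
      (auto simp: layer_dims_def probe_def probe_head_def)
  have Zij: "Z $$ (i, j) = X $$ (i, j) + (if j = 0 then C else 0)" if "i < n" "j < d" for i j
    using X that
    by (simp add: Z_def apply_layer_def heads_sum_def Let_def probe_def scalar_prod_def)
  have V: "(rpe_attention \<Psi> ?h Z * Z * W_V ?h) $$ (i, 0) = (\<Sum>k<n. g (\<Psi> $$ (i, k)) / n * Z $$ (k, 0))"
    if "0 < d"
  proof -
    have att: "rpe_attention \<Psi> ?h Z \<in> carrier_mat n n" by (rule rpe_attention_carrier[OF \<Psi>])
    have WV: "W_V ?h \<in> carrier_mat d 1" by (simp add: probe_head_def)
    have "(rpe_attention \<Psi> ?h Z * Z * W_V ?h) $$ (i, 0) =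
        (\<Sum>q<d. (rpe_attention \<Psi> ?h Z * Z) $$ (i, q) * W_V ?h $$ (q, 0))"
      using att Z WV i by (intro index_mult_mat_sum) auto
    also have "\<dots> = (\<Sum>q<d. if q = 0 then (rpe_attention \<Psi> ?h Z * Z) $$ (i, 0) else 0)"
      by (intro sum.cong) (auto simp: probe_head_def)
    also have "\<dots> = (rpe_attention \<Psi> ?h Z * Z) $$ (i, 0)"
      using that by simp
    also have "\<dots> = (\<Sum>k<n. rpe_attention \<Psi> ?h Z $$ (i, k) * Z $$ (k, 0))"
      using att Z i that by (intro index_mult_mat_sum) auto
    finally show ?thesis
      using i by (simp add: rpe_attention_probe_head[OF \<Psi> Z])
  qed
  have "run_transformer (rpe_attention \<Psi>) (probe d C g) X = apply_layer (rpe_attention \<Psi>) (\<lambda>_. 1) ?L2 Z"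
    by (simp add: run_transformer_def Z_def probe_def)
  also have "\<dots> $$ (i, j) = Z $$ (i, j) +
      (if j = 0 then (rpe_attention \<Psi> ?h Z * Z * W_V ?h) $$ (i, 0) else 0)"
    using Z i j by (simp add: apply_layer_def heads_sum_def Let_def probe_def scalar_prod_def)
  finally show ?thesis
    using i j by (auto simp: Zij V)
qed

section \<open>Indistinguishability\<close>

lemma enumerates_exists:
  assumes "featured_graph d G X"
  obtains vs where "enumerates vs G"
proof -
  have "finite (pverts G)"
    using assms by (simp add: featured_graph_def pair_fin_digraph.pair_finite_verts)
  then show thesis
    using finite_distinct_list that unfolding enumerates_def by metis
qed

lemma mset_enumerates: "enumerates vs G \<Longrightarrow> mset vs = mset_set (pverts G)"
  by (metis enumerates_def mset_set_set)

definition node_types ::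
  "('v pair_pre_digraph \<Rightarrow> 'v \<Rightarrow> real vec) \<Rightarrow> 'v pair_pre_digraph \<Rightarrow> ('v \<Rightarrow> real vec) \<Rightarrow>
   (real vec \<times> real vec) multiset" where
  "node_types \<phi> G X = image_mset (\<lambda>v. (X v, \<phi> G v)) (mset_set (pverts G))"

text \<open>Lists with equal multisets differ by a permutation of positions. The matching preserves
  features and encodings but need not be a graph isomorphism: a transformer sees the graph only
  through the encoding.\<close>

lemma node_types_eq_matching:
  assumes "enumerates vs G" "enumerates ws H" "node_types \<phi> G X = node_types \<phi> H X'"
  obtains \<pi> where "\<pi> permutes {..<length ws}" "length vs = length ws"
    "\<And>i. i < length ws \<Longrightarrow> X (vs ! i) = X' (ws ! \<pi> i) \<and> \<phi> G (vs ! i) = \<phi> H (ws ! \<pi> i)"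
proof -
  let ?xs = "map (\<lambda>v. (X v, \<phi> G v)) vs" and ?ys = "map (\<lambda>v. (X' v, \<phi> H v)) ws"
  have "mset ?xs = mset ?ys"
    using assms by (simp add: node_types_def mset_enumerates)
  then obtain \<pi> where \<pi>: "\<pi> permutes {..<length ?ys}" "permute_list \<pi> ?ys = ?xs"
    by (rule mset_eq_permutation)
  have len: "length vs = length ws"
    using arg_cong[OF \<pi>(2), of length] by simp
  have "X (vs ! i) = X' (ws ! \<pi> i) \<and> \<phi> G (vs ! i) = \<phi> H (ws ! \<pi> i)" if "i < length ws" for i
    using arg_cong[OF \<pi>(2), of "\<lambda>zs. zs ! i"] \<pi>(1) len that by (simp add: permute_list_nth)
  with \<pi>(1) len show thesis by (intro that) auto
qed

lemma mat_of_rows_permute_rows: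
  assumes "\<pi> permutes {..<length ys}" "length xs = length ys"
    and "\<And>i. i < length ys \<Longrightarrow> xs ! i = ys ! \<pi> i"
  shows "mat_of_rows m xs = permute_rows \<pi> (mat_of_rows m ys)"
  using assms by (intro eq_matI) (auto simp: mat_of_rows_index)

section \<open>Equal node types imply indistinguishability\<close>

lemma APE_GT_indistinguishable:
  assumes types: "node_types \<phi> G X = node_types \<phi> H X'" and F: "F \<in> APE_GTs d l \<phi>"
  shows "indistinguishable F (G, X) (H, X')"
  unfolding indistinguishable_def prod.case
proof (intro allI impI)
  fix vs ws assume vw: "enumerates vs G \<and> enumerates ws H"
  then obtain \<pi> where \<pi>: "\<pi> permutes {..<length ws}" "length vs = length ws"
    "\<And>i. i < length ws \<Longrightarrow> X (vs ! i) = X' (ws ! \<pi> i) \<and> \<phi> G (vs ! i) = \<phi> H (ws ! \<pi> i)"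
    using node_types_eq_matching[OF _ _ types] by metis
  \<comment> \<open>The map \<open>r\<close> stands for concatenation or addition, so both variants
    are treated at once.\<close>
  obtain T m r where T: "transformer_dims m T"
    and Feq: "F = (\<lambda>G vs X. run_transformer attention T (mat_of_rows m (map (\<lambda>v. r (X v) (\<phi> G v)) vs)))"
    using F unfolding APE_GTs_def by blast
  have "mat_of_rows m (map (\<lambda>v. r (X v) (\<phi> G v)) vs) =
      permute_rows \<pi> (mat_of_rows m (map (\<lambda>v. r (X' v) (\<phi> H v)) ws))"
    using \<pi> by (intro mat_of_rows_permute_rows) auto
  then show "mset (rows (F G vs X)) = mset (rows (F H ws X'))"
    unfolding Feq
    by (simp only:) (rule mset_rows_run_transformer_eq[OF \<pi>(1) T],
        auto intro: attention_carrier attention_permute_rows[OF \<pi>(1)])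
qed

lemma RPE_GT_indistinguishable:
  assumes types: "node_types \<phi> G X = node_types \<phi> H X'" and F: "F \<in> RPE_GTs d (induced_RPE f \<phi>)"
  shows "indistinguishable F (G, X) (H, X')"
  unfolding indistinguishable_def prod.case
proof (intro allI impI)
  fix vs ws assume vw: "enumerates vs G \<and> enumerates ws H"
  then obtain \<pi> where \<pi>: "\<pi> permutes {..<length ws}" "length vs = length ws"
    "\<And>i. i < length ws \<Longrightarrow> X (vs ! i) = X' (ws ! \<pi> i) \<and> \<phi> G (vs ! i) = \<phi> H (ws ! \<pi> i)"
    using node_types_eq_matching[OF _ _ types] by metis
  let ?\<Psi> = "\<lambda>G vs. mat (length vs) (length vs) (\<lambda>(i, j). induced_RPE f \<phi> G (vs ! i) (vs ! j))"
  obtain T where T: "transformer_dims d T"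
    and Feq: "F = (\<lambda>G vs X. run_transformer (rpe_attention (?\<Psi> G vs)) T (mat_of_rows d (map X vs)))"
    using F unfolding RPE_GTs_def by blast
  \<comment> \<open>An entry depends only on the encodings of its two nodes, which the matching
    preserves, whatever \<open>f\<close> is.\<close>
  have "?\<Psi> G vs = permute_both \<pi> (?\<Psi> H ws)"
    using \<pi> by (intro eq_matI) (auto simp: induced_RPE_def)
  moreover have "mat_of_rows d (map X vs) = permute_rows \<pi> (mat_of_rows d (map X' ws))"
    using \<pi> by (intro mat_of_rows_permute_rows) auto
  moreover have "?\<Psi> H ws \<in> carrier_mat (length ws) (length ws)" by simp
  ultimately show "mset (rows (F G vs X)) = mset (rows (F H ws X'))"
    unfolding Feq
    by (simp only:) (rule mset_rows_run_transformer_eq[OF \<pi>(1) T],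
        auto intro: rpe_attention_carrier rpe_attention_permute_rows[OF \<pi>(1)])
qed

section \<open>Separation by absolute encodings\<close>

definition zero_transformer :: "nat \<Rightarrow> attn_head transformer" where
  "zero_transformer d = \<lparr>activation = (\<lambda>_. 0), layers =
     [\<lparr>heads = [\<lparr>W_Q = 0\<^sub>m d 1, W_K = 0\<^sub>m d 1, W_V = 0\<^sub>m d 1\<rparr>], W_O = 0\<^sub>m 1 d, W_1 = 0\<^sub>m d 1,
        W_2 = 0\<^sub>m 1 d\<rparr>]\<rparr>"

lemma zero_transformer_dims: "transformer_dims d (zero_transformer d)"
  unfolding transformer_dims_def
  by (intro conjI exI[of _ 1]) (auto simp: zero_transformer_def)

text \<open>Only the residual connections survive, so the output is the encoded input
  itself.\<close>

lemma run_zero_transformer: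
  assumes "X \<in> carrier_mat n d"
  shows "run_transformer att (zero_transformer d) X = X"
  using assms
  by (intro eq_matI)
    (auto simp: run_transformer_def zero_transformer_def apply_layer_def Let_def heads_sum_def scalar_prod_def)

text \<open>The concatenating variant is used: it exists for all \<open>d\<close> and
  \<open>l\<close> and loses no information, whereas a sum may identify different pairs.\<close>

lemma node_types_eq_if_APE_GTs_indistinguishable:
  assumes G: "featured_graph d G X" and H: "featured_graph d H X'" and \<phi>: "is_APE l \<phi>"
    and ind: "\<forall>F\<in>APE_GTs d l \<phi>. indistinguishable F (G, X) (H, X')"
  shows "node_types \<phi> G X = node_types \<phi> H X'"
proof -
  let ?F = "\<lambda>G vs X. run_transformer attention (zero_transformer (d + l))
    (mat_of_rows (d + l) (map (\<lambda>v. X v @\<^sub>v \<phi> G v) vs))"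
  have "?F \<in> APE_GTs d l \<phi>"
    using zero_transformer_dims unfolding APE_GTs_def by blast
  then have F: "indistinguishable ?F (G, X) (H, X')"
    using ind by blast
  have rows_types: "mset (rows (?F G vs X)) = image_mset (\<lambda>(x, y). x @\<^sub>v y) (node_types \<phi> G X) \<and>
      set_mset (node_types \<phi> G X) \<subseteq> carrier_vec d \<times> carrier_vec l"
    if "featured_graph d G X" "enumerates vs G" for G vs and X :: "'a \<Rightarrow> real vec"
  proof -
    have car: "X v \<in> carrier_vec d" "\<phi> G v \<in> carrier_vec l" if "v \<in> set vs" for v
      using that \<open>featured_graph d G X\<close> \<open>enumerates vs G\<close> \<phi>
      by (auto simp: featured_graph_def enumerates_def is_APE_def)
    have "rows (?F G vs X) = map (\<lambda>v. X v @\<^sub>v \<phi> G v) vs"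
      using car by (subst run_zero_transformer[of _ "length vs"]) (auto intro!: rows_mat_of_rows)
    then have "mset (rows (?F G vs X)) = image_mset (\<lambda>v. X v @\<^sub>v \<phi> G v) (mset vs)"
      by simp
    moreover have "node_types \<phi> G X = image_mset (\<lambda>v. (X v, \<phi> G v)) (mset vs)"
      by (simp add: node_types_def mset_enumerates[OF that(2)])
    ultimately show ?thesis
      using car by (auto simp: image_mset.compositionality o_def)
  qed
  obtain vs ws where vw: "enumerates vs G" "enumerates ws H"
    using G H enumerates_exists by metis
  with F have "mset (rows (?F G vs X)) = mset (rows (?F H ws X'))"
    unfolding indistinguishable_def prod.case by blast
  \<comment> \<open>The fixed dimension \<open>d\<close> of the first block tells where to cut a
    concatenated row.\<close>
  moreover have "inj_on (\<lambda>(x, y). x @\<^sub>v y) (carrier_vec d \<times> carrier_vec l :: (real vec \<times> real vec) set)"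
    by (auto simp: inj_on_def append_vec_eq)
  ultimately show ?thesis
    using rows_types[OF G vw(1)] rows_types[OF H vw(2)]
    by (metis (no_types, lifting) inj_on_image_mset_eqD)
qed

section \<open>Separation by the induced relative encoding\<close>

lemma sum_nth_if_eq_sum_mset:
  fixes F :: "'a \<Rightarrow> real"
  shows "(\<Sum>k<length vs. if P (vs ! k) then F (vs ! k) else 0) = (\<Sum>v\<in>#filter_mset P (mset vs). F v)"
  by (induction vs) (auto simp: sum.lessThan_Suc_shift simp del: sum.lessThan_Suc cong: if_cong)

abbreviation paraboloid :: "real vec \<Rightarrow> real vec" where
  "paraboloid a \<equiv> vCons (a \<bullet> a) a"

abbreviation shift :: "nat \<Rightarrow> real \<Rightarrow> real vec \<Rightarrow> real vec" where
  "shift d r x \<equiv> x + r \<cdot>\<^sub>v unit_vec d 0"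

text \<open>A node encoded by \<open>p\<close> attends exactly to the nodes encoded by
  \<open>p\<close>, hence all of them gain the same multiple of one sum over \<open>A\<close>; every
  other node attends to none and gains only \<open>C\<close>. The result has the form treated in
  \<open>multiset_shift_separation\<close>, with \<open>t\<close> divided by the number of nodes as
  \<open>K\<close>.\<close>

lemma mset_rows_probe:
  assumes G: "featured_graph d G X" and d: "1 \<le> d" and vs: "enumerates vs G"
    and \<phi>: "is_APE l \<phi>" and p: "p \<in> carrier_vec l"
    and V: "V = mset_set (pverts G)"
    and A: "A = image_mset X (filter_mset (\<lambda>v. \<phi> G v = p) V)"
    and B: "B = image_mset X (filter_mset (\<lambda>v. \<phi> G v \<noteq> p) V)"
  shows "mset (rows (run_transformer
      (rpe_attention (mat (length vs) (length vs) (\<lambda>(i, j). induced_RPE paraboloid \<phi> G (vs ! i) (vs ! j))))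
      (probe d C (\<lambda>z. if z = paraboloid p + paraboloid p then t else 0)) (mat_of_rows d (map X vs)))) =
    image_mset (shift d (C + t / card (pverts G) * (\<Sum>x\<in>#A. x $ 0 + C))) A + image_mset (shift d C) B"
proof -
  let ?n = "length vs"
  let ?\<Psi> = "mat ?n ?n (\<lambda>(i, j). induced_RPE paraboloid \<phi> G (vs ! i) (vs ! j))"
  let ?g = "\<lambda>z. if z = paraboloid p + paraboloid p then t else 0"
  let ?M = "mat_of_rows d (map X vs)"
  let ?R = "run_transformer (rpe_attention ?\<Psi>) (probe d C ?g) ?M"
  define c where "c = (\<Sum>x\<in>#A. x $ 0 + C)"
  define r where "r v = (if \<phi> G v = p then C + t / ?n * c else C)" for v
  have car: "X v \<in> carrier_vec d" "\<phi> G v \<in> carrier_vec l" if "v \<in> set vs" for v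
    using that G vs \<phi> by (auto simp: featured_graph_def enumerates_def is_APE_def)
  have n: "card (pverts G) = ?n"
    using vs by (metis distinct_card enumerates_def)
  have Vvs: "V = mset vs"
    using vs V by (simp add: mset_enumerates)
  have R: "?R \<in> carrier_mat ?n d"
    by (intro run_transformer_carrier[OF probe_dims]) auto
  have sumc: "(\<Sum>k<?n. ?g (?\<Psi> $$ (i, k)) / ?n * (?M $$ (k, 0) + C)) = (if \<phi> G (vs ! i) = p then t / ?n * c else 0)"
    if i: "i < ?n" for i
  proof -
    \<comment> \<open>By \<open>paraboloid_midpoint\<close>, the test on the sum of two lifted
      encodings is a test on each of the two nodes.\<close>
    have g: "?g (?\<Psi> $$ (i, k)) = (if \<phi> G (vs ! i) = p \<and> \<phi> G (vs ! k) = p then t else 0)" if "k < ?n" for k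
      using that i paraboloid_midpoint[of "\<phi> G (vs ! i)" l "\<phi> G (vs ! k)" p] car p
      by (auto simp: induced_RPE_def)
    have "(\<Sum>k<?n. ?g (?\<Psi> $$ (i, k)) / ?n * (?M $$ (k, 0) + C)) =
        (\<Sum>k<?n. (if \<phi> G (vs ! i) = p then t / ?n else 0) * (if \<phi> G (vs ! k) = p then X (vs ! k) $ 0 + C else 0))"
      using d by (intro sum.cong) (auto simp: g mat_of_rows_index simp del: index_mat)
    also have "\<dots> = (if \<phi> G (vs ! i) = p then t / ?n else 0) * c"
      unfolding c_def A Vvs image_mset.compositionality o_def sum_distrib_left[symmetric]
        sum_nth_if_eq_sum_mset[where P = "\<lambda>v. \<phi> G v = p" and F = "\<lambda>v. X v $ 0 + C"] ..
    finally show ?thesis by simp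
  qed
  have "rows ?R = map (\<lambda>v. shift d (r v) (X v)) vs"
  proof (rule nth_equalityI)
    fix i assume "i < length (rows ?R)"
    with R have i: "i < ?n" by simp
    have "row ?R i = shift d (r (vs ! i)) (X (vs ! i))"
    proof (rule eq_vecI)
      fix j assume "j < dim_vec (shift d (r (vs ! i)) (X (vs ! i)))"
      then have j: "j < d" by simp
      have "?R $$ (i, j) = ?M $$ (i, j) + (if j = 0 then C + (\<Sum>k<?n. ?g (?\<Psi> $$ (i, k)) / ?n * (?M $$ (k, 0) + C)) else 0)"
        using i j by (intro run_probe) auto
      also have "\<dots> = X (vs ! i) $ j + (if j = 0 then r (vs ! i) else 0)"
        using i j unfolding sumc[OF i] by (simp add: mat_of_rows_index r_def)
      finally show "row ?R i $ j = shift d (r (vs ! i)) (X (vs ! i)) $ j"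
        using i j R car[of "vs ! i"] by auto
    qed (use R in simp)
    then show "rows ?R ! i = map (\<lambda>v. shift d (r v) (X v)) vs ! i"
      using i R by simp
  qed (use R in simp)
  then have "mset (rows ?R) = image_mset (\<lambda>v. shift d (r v) (X v)) V"
    by (simp add: Vvs)
  also have "\<dots> = image_mset (\<lambda>v. shift d (r v) (X v)) (filter_mset (\<lambda>v. \<phi> G v = p) V) +
      image_mset (\<lambda>v. shift d (r v) (X v)) (filter_mset (\<lambda>v. \<phi> G v \<noteq> p) V)"
    by (metis image_mset_union multiset_partition)
  also have "\<dots> = image_mset (shift d (C + t / ?n * c)) A + image_mset (shift d C) B"
    unfolding A B image_mset.compositionality o_def
    by (intro arg_cong2[of _ _ _ _ "(+)"] image_mset_cong) (auto simp: r_def)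
  finally show ?thesis
    unfolding c_def n .
qed

text \<open>This reduces equality of node types to one encoding value \<open>p\<close> at a time,
  which is what a single probe examines.\<close>

lemma count_node_types:
  "count (node_types \<phi> G X) (x, p) =
    count (image_mset X (filter_mset (\<lambda>v. \<phi> G v = p) (mset_set (pverts G)))) x"
proof -
  have "count (image_mset (\<lambda>v. (X v, \<phi> G v)) M) (x, p) =
      count (image_mset X (filter_mset (\<lambda>v. \<phi> G v = p) M)) x" for M
    by (induction M) auto
  then show ?thesis by (simp add: node_types_def)
qed

lemma node_types_eq_if_RPE_GTs_indistinguishable:
  assumes G: "featured_graph d G X" and H: "featured_graph d H X'" and d: "1 \<le> d" and \<phi>: "is_APE l \<phi>"
    and ind: "\<forall>F\<in>RPE_GTs d (induced_RPE paraboloid \<phi>). indistinguishable F (G, X) (H, X')"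
  shows "node_types \<phi> G X = node_types \<phi> H X'"
proof (rule multiset_eqI, rule prod.induct)
  fix x p
  \<comment> \<open>The predicate \<open>Q\<close> lets one definition cover both the class of
    \<open>p\<close> and its complement.\<close>
  define part where "part Q G X = image_mset X (filter_mset (\<lambda>v. Q (\<phi> G v)) (mset_set (pverts G)))"
    for Q G and X :: "'a \<Rightarrow> real vec"
  have fin: "finite (pverts G)" "finite (pverts H)"
    using G H by (auto simp: featured_graph_def pair_fin_digraph.pair_finite_verts)
  have car: "v \<in> pverts G \<Longrightarrow> X v \<in> carrier_vec d \<and> \<phi> G v \<in> carrier_vec l"
    "v \<in> pverts H \<Longrightarrow> X' v \<in> carrier_vec d \<and> \<phi> H v \<in> carrier_vec l" for v
    using G H \<phi> by (auto simp: featured_graph_def is_APE_def)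
  have "part (\<lambda>q. q = p) G X = part (\<lambda>q. q = p) H X'"
  \<comment> \<open>A vector of the wrong dimension encodes no node, so both classes are
    empty.\<close>
  proof (cases "p \<in> carrier_vec l")
    case False
    then have "filter_mset (\<lambda>v. \<phi> G v = p) (mset_set (pverts G)) = {#}"
      "filter_mset (\<lambda>v. \<phi> H v = p) (mset_set (pverts H)) = {#}"
      unfolding filter_mset_eq_mempty_iff using fin car by auto
    then show ?thesis unfolding part_def by (simp only: image_mset_empty)
  next
    case p: True
    \<comment> \<open>\<open>C\<close> and \<open>t\<close> stay free: a first use compares the
      numbers of nodes, and a second one, with constants depending on that number, separates the
      classes.\<close>
    have probe: "image_mset (shift d (C + t / card (pverts G) * (\<Sum>x\<in>#part (\<lambda>q. q = p) G X. x $ 0 + C)))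
          (part (\<lambda>q. q = p) G X) + image_mset (shift d C) (part (\<lambda>q. q \<noteq> p) G X) =
        image_mset (shift d (C + t / card (pverts H) * (\<Sum>x\<in>#part (\<lambda>q. q = p) H X'. x $ 0 + C)))
          (part (\<lambda>q. q = p) H X') + image_mset (shift d C) (part (\<lambda>q. q \<noteq> p) H X')" for C t
    proof -
      let ?F = "\<lambda>G vs X. run_transformer
        (rpe_attention (mat (length vs) (length vs) (\<lambda>(i, j). induced_RPE paraboloid \<phi> G (vs ! i) (vs ! j))))
        (probe d C (\<lambda>z. if z = paraboloid p + paraboloid p then t else 0)) (mat_of_rows d (map X vs))"
      have "?F \<in> RPE_GTs d (induced_RPE paraboloid \<phi>)"
        using probe_dims unfolding RPE_GTs_def by blast
      then have F: "indistinguishable ?F (G, X) (H, X')"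
        using ind by blast
      obtain vs ws where vw: "enumerates vs G" "enumerates ws H"
        using G H enumerates_exists by metis
      with F have "mset (rows (?F G vs X)) = mset (rows (?F H ws X'))"
        unfolding indistinguishable_def prod.case by blast
      then show ?thesis
        unfolding mset_rows_probe[OF G d vw(1) \<phi> p refl refl refl]
          mset_rows_probe[OF H d vw(2) \<phi> p refl refl refl] part_def .
    qed
    have size_part: "size (part (\<lambda>q. q = p) G X) + size (part (\<lambda>q. q \<noteq> p) G X) = card (pverts G)"
      for G and X :: "'a \<Rightarrow> real vec"
      unfolding part_def size_image_mset
      by (metis multiset_partition size_mset_set size_union)
    \<comment> \<open>Uniform attention divides by the number of nodes, so these numbers must agree
      before one value of \<open>t\<close> can produce the same factor on both graphs.\<close>
    have n: "card (pverts G) = card (pverts H)"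
      using arg_cong[OF probe[of 0 0], of size] size_part[of G X] size_part[of H X'] by simp
    show ?thesis
    \<comment> \<open>With no nodes the division by their number would not return \<open>K\<close>;
      both graphs are then empty.\<close>
    proof (cases "card (pverts G) = 0")
      case True
      with n fin show ?thesis by (simp add: part_def)
    next
      case False
      let ?S = "X ` pverts G \<union> X' ` pverts H"
      have "bdd_above ((\<lambda>x. \<bar>x $ 0\<bar>) ` ?S)"
        using fin by (intro bdd_above_finite) auto
      then obtain b where b: "\<And>x. x \<in> ?S \<Longrightarrow> \<bar>x $ 0\<bar> \<le> b"
        unfolding bdd_above_def by (metis imageI)
      have sub: "set_mset (part (\<lambda>q. q = p) G X) \<union> set_mset (part (\<lambda>q. q \<noteq> p) G X) \<union>
          set_mset (part (\<lambda>q. q = p) H X') \<union> set_mset (part (\<lambda>q. q \<noteq> p) H X') \<subseteq> ?S"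
        using fin by (auto simp: part_def)
      show ?thesis
      \<comment> \<open>Since \<open>b\<close> bounds the absolute first coordinates, adding
        \<open>1 + b\<close> lifts them into the interval from 1 to \<open>1 + 2 * b\<close>, whose
        upper end serves as \<open>K\<close>. Choosing \<open>t\<close> as \<open>K\<close> times
        the number of nodes leaves exactly the factor \<open>K\<close> after the division.\<close>
      proof (rule multiset_shift_separation[where s = "shift d" and S = "carrier_vec d" and
            h = "\<lambda>x. x $ 0" and C = "1 + b" and K = "1 + 2 * b", OF _ _ _ _ refl refl])
        show "inj_on (shift d r) (carrier_vec d)" for r
        proof (rule inj_onI)
          fix x y assume xy: "x \<in> carrier_vec d" "y \<in> carrier_vec d" and eq: "shift d r x = shift d r y"
          have "x $ i = y $ i" if "i < d" for i
            using arg_cong[OF eq, of "\<lambda>z. z $ i"] that by simp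
          with xy show "x = y" by (intro eq_vecI) auto
        qed
        show "shift d r x $ 0 = x $ 0 + r" if "x \<in> carrier_vec d" for r x
          using that d by simp
        show "set_mset (part (\<lambda>q. q = p) G X) \<union> set_mset (part (\<lambda>q. q \<noteq> p) G X) \<union>
            set_mset (part (\<lambda>q. q = p) H X') \<union> set_mset (part (\<lambda>q. q \<noteq> p) H X') \<subseteq> carrier_vec d"
          using sub car by blast
        show "1 \<le> x $ 0 + (1 + b) \<and> x $ 0 + (1 + b) \<le> 1 + 2 * b"
          if "x \<in> set_mset (part (\<lambda>q. q = p) G X) \<union> set_mset (part (\<lambda>q. q \<noteq> p) G X) \<union>
            set_mset (part (\<lambda>q. q = p) H X') \<union> set_mset (part (\<lambda>q. q \<noteq> p) H X')" for x
          using b[of x] that sub by (auto simp: abs_le_iff)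
      qed (use probe[of "1 + b" "(1 + 2 * b) * card (pverts G)"] n False in simp)
    qed
  qed
  then show "count (node_types \<phi> G X) (x, p) = count (node_types \<phi> H X') (x, p)"
    by (simp add: count_node_types part_def)
qed

theorem theorem3p8:
  fixes \<phi> :: "'v pair_pre_digraph \<Rightarrow> 'v \<Rightarrow> real vec" and l :: nat
  assumes "is_APE l \<phi>"
  shows "\<exists>(k::nat) (f :: real vec \<Rightarrow> real vec).
           1 \<le> k \<and> f \<in> carrier_vec l \<rightarrow> carrier_vec k \<and> is_RPE k (induced_RPE f \<phi>) \<and>
           (\<forall>(d::nat) G X\<^sub>G H X\<^sub>H.
              1 \<le> d \<and> featured_graph d G X\<^sub>G \<and> featured_graph d H X\<^sub>H \<longrightarrow>
              ((\<forall>F\<in>APE_GTs d l \<phi>. indistinguishable F (G, X\<^sub>G) (H, X\<^sub>H)) \<longleftrightarrow>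
               (\<forall>F\<in>RPE_GTs d (induced_RPE f \<phi>). indistinguishable F (G, X\<^sub>G) (H, X\<^sub>H))))"
\<comment> \<open>The lift adds one coordinate, whence \<open>Suc l\<close>, which is positive even
  for \<open>l = 0\<close>.\<close>
proof (intro exI[of _ "Suc l"] exI[of _ paraboloid] conjI allI impI)
  show "is_RPE (Suc l) (induced_RPE paraboloid \<phi>)"
    unfolding is_RPE_def induced_RPE_def
  proof (intro conjI allI impI ballI)
    fix G :: "'v pair_pre_digraph" and u v assume "pair_fin_digraph G" "u \<in> pverts G" "v \<in> pverts G"
    then show "paraboloid (\<phi> G u) + paraboloid (\<phi> G v) \<in> carrier_vec (Suc l)"
      using assms by (auto simp: is_APE_def intro!: add_carrier_vec)
  next
    fix G H :: "'v pair_pre_digraph" and \<sigma> u v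
    assume "pair_fin_digraph G \<and> pair_fin_digraph H \<and> graph_isomorphism G H \<sigma>" "u \<in> pverts G" "v \<in> pverts G"
    then have "\<phi> G u = \<phi> H (\<sigma> u)" "\<phi> G v = \<phi> H (\<sigma> v)"
      using assms by (auto simp: is_APE_def)
    then show "paraboloid (\<phi> G u) + paraboloid (\<phi> G v) = paraboloid (\<phi> H (\<sigma> u)) + paraboloid (\<phi> H (\<sigma> v))"
      by simp
  qed
next
  fix d and G H :: "'v pair_pre_digraph" and X X' :: "'v \<Rightarrow> real vec"
  assume "1 \<le> d \<and> featured_graph d G X \<and> featured_graph d H X'"
  then have d: "1 \<le> d" and G: "featured_graph d G X" and H: "featured_graph d H X'"
    by auto
  show "(\<forall>F\<in>APE_GTs d l \<phi>. indistinguishable F (G, X) (H, X')) \<longleftrightarrow>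
    (\<forall>F\<in>RPE_GTs d (induced_RPE paraboloid \<phi>). indistinguishable F (G, X) (H, X'))"
    \<comment> \<open>Each side of the equivalence holds exactly when the node types agree.\<close>
    using node_types_eq_if_APE_GTs_indistinguishable[OF G H assms] APE_GT_indistinguishable[of \<phi> G X H X']
      node_types_eq_if_RPE_GTs_indistinguishable[OF G H d assms] RPE_GT_indistinguishable[of \<phi> G X H X']
    by blast
qed auto

end
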